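(* Let $\alpha>0$ and $\beta\ge 0$ be real numbers, and let $f\in\mathcal{A}$ satisfy $f(z)f'(z)/z\neq 0$ for all $z\in\mathbb{D}$. If at least one of the following inequalities holds for all $z\in\mathbb{D}$: (i) $\operatorname{Re}\big(\beta Q_{SD}Q_{ST}+\alpha(1+Q_{CV})^2\big)>\alpha$; (ii) $\operatorname{Re}\big(\beta Q_{SD}Q_{ST}+\alpha(1+Q_{ST})^2\big)>\alpha$; (iii) $\operatorname{Re}\big(\beta Q_{SD}Q_{CV}+\alpha(1+Q_{CV})^2\big)>\alpha$; (iv) $\operatorname{Re}\big(\beta Q_{SD}Q_{CV}+\alpha(1+Q_{ST})^2\big)>\alpha$; then $f$ is starlike.
   Context: $\mathbb{D}=\{z\in\mathbb{C}:|z|<1\}$. $\mathcal{A}$ is the class of analytic functions $f:\mathbb{D}\to\mathbb{C}$ with $f(0)=0$ and $f'(0)=1$. For $f\in\mathcal{A}$, as functions of $z\in\mathbb{D}$: $Q_{ST}=zf'(z)/f(z)$ (with the removable singularity at $z=0$ filled in, value $1$), $Q_{CV}=1+zf''(z)/f'(z)$, and $Q_{SD}=z^2\Big(\big(f''(z)/f'(z)\big)'-\tfrac12\big(f''(z)/f'(z)\big)^2\Big)$ ($z^2$ times the Schwarzian derivative of $f$). The condition $f(z)f'(z)/z\neq0$ is understood at $z=0$ via the removable singularity (where the value is $1$). A function $f\in\mathcal{A}$ is starlike if $\operatorname{Re}Q_{ST}>0$ on $\mathbb{D}$; equivalently, $f$ is univalent and $tf(z)\in f(\mathbb{D})$ for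 all $z\in\mathbb{D}$, $t\in[0,1]$. *)

theory Defs
  imports "HOL-Complex_Analysis.Complex_Analysis"
begin

abbreviation unit_disc :: "complex set" where
  "unit_disc \<equiv> ball 0 1"

definition class_A :: "(complex \<Rightarrow> complex) set" where
  "class_A = {f. f holomorphic_on unit_disc \<and> f 0 = 0 \<and> deriv f 0 = 1}"

text \<open>For \<open>f\<close> in \<open>class_A\<close>, both \<open>z f'(z) / f(z)\<close> and \<open>f(z) f'(z) / z\<close> have a removable
  singularity at \<open>0\<close> with limit \<open>1\<close>. Both are filled in explicitly, since a quotient by zero is
  \<open>0\<close> in HOL.\<close>

definition Q_ST :: "(complex \<Rightarrow> complex) \<Rightarrow> complex \<Rightarrow> complex" where
  "Q_ST f z = (if z = 0 then 1 else z * deriv f z / f z)"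

definition ff'_over_z :: "(complex \<Rightarrow> complex) \<Rightarrow> complex \<Rightarrow> complex" where
  "ff'_over_z f z = (if z = 0 then 1 else f z * deriv f z / z)"

definition Q_CV :: "(complex \<Rightarrow> complex) \<Rightarrow> complex \<Rightarrow> complex" where
  "Q_CV f z = 1 + z * deriv (deriv f) z / deriv f z"

definition schwarzian :: "(complex \<Rightarrow> complex) \<Rightarrow> complex \<Rightarrow> complex" where
  "schwarzian f z = deriv (\<lambda>w. deriv (deriv f) w / deriv f w) z
     - 1 / 2 * (deriv (deriv f) z / deriv f z)\<^sup>2"

definition Q_SD :: "(complex \<Rightarrow> complex) \<Rightarrow> complex \<Rightarrow> complex" where
  "Q_SD f z = z\<^sup>2 * schwarzian f z"

text \<open>Starlikeness of a function, not to be confused with the library's \<open>starlike\<close> for sets.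
  A zero \<open>z \<noteq> 0\<close> of \<open>f\<close> gives \<open>Q_ST f z = 0\<close>, so the condition also excludes such zeros.\<close>

definition starlike_function :: "(complex \<Rightarrow> complex) \<Rightarrow> bool" where
  "starlike_function f \<longleftrightarrow> f \<in> class_A \<and> (\<forall>z\<in>unit_disc. Re (Q_ST f z) > 0)"

end

theory Submission
  imports Defs
begin

text \<open>
  The argument looks at the first point where \<open>p = Q_ST f\<close> leaves the right half-plane.
  Write \<open>D = z d/dz\<close>. All quantities in the theorem are expressions in \<open>p\<close>:
  \<open>Q_CV f = p + D p / p\<close>, and
  \<open>Q_SD f = D (D p) / p - 3/2 (D p / p)\<^sup>2 + (1 - p\<^sup>2) / 2\<close>.

  If \<open>f\<close> is not starlike, then, as \<open>p 0 = 1\<close>, there is a point \<open>z \<noteq> 0\<close> of least modulus with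
  \<open>Re (p z) = 0\<close>. There \<open>Re p\<close> restricted to the circle through \<open>z\<close> is minimal, and \<open>Re p\<close> has
  not increased along the radius to \<open>z\<close>. Since \<open>d/dt = \<i> D\<close> along the circle \<open>z exp (\<i> t)\<close>, the
  first and second derivative tests give \<open>Im (D p) = 0\<close> and \<open>Re (D (D p)) \<le> 0\<close>, and the radial
  derivative gives \<open>Re (D p) \<le> 0\<close> (lemma \<open>euler_at_first_imaginary_value\<close>).

  Now \<open>p z = \<i> \<rho>\<close> with \<open>\<rho> \<noteq> 0\<close>, and \<open>D p = \<sigma> \<le> 0\<close> is real. Then \<open>Q_CV f z\<close> is \<open>1 - \<sigma> / \<rho>\<^sup>2\<close>
  times \<open>p z\<close>, a positive multiple, and is imaginary too. In \<open>Q_SD f z * p z\<close> every term other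
  than \<open>D (D p)\<close> is imaginary, so its real part is not positive (lemma \<open>obstruction\<close>). For an
  imaginary number \<open>\<i> b\<close> one has \<open>Re ((1 + \<i> b)\<^sup>2) = 1 - b\<^sup>2 \<le> 1\<close>. Hence none of the four
  inequalities can hold at \<open>z\<close>.
\<close>

section \<open>The operator \<open>z d/dz\<close> at a first imaginary value\<close>

definition euler :: "(complex \<Rightarrow> complex) \<Rightarrow> complex \<Rightarrow> complex" where
  "euler g z = z * deriv g z"

lemma holomorphic_on_euler:
  assumes "g holomorphic_on S" "open S"
  shows "euler g holomorphic_on S"
  unfolding euler_def by (intro holomorphic_intros assms)

lemma euler_quotient:
  assumes "g field_differentiable at z" "h field_differentiable at z" "h z \<noteq> 0"
  shows "euler (\<lambda>w. g w / h w) z = (euler g z * h z - g z * euler h z) / (h z)\<^sup>2"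
  using assms by (simp add: euler_def deriv_divide algebra_simps diff_divide_distrib)

text \<open>The necessary second-order condition: if \<open>c < 0\<close>, then \<open>u'\<close> is negative just to the right
  of \<open>a\<close>, and \<open>u\<close> falls below \<open>u a\<close>.\<close>

lemma second_deriv_nonneg_at_min:
  fixes u :: "real \<Rightarrow> real"
  assumes u': "\<And>x. (u has_real_derivative u' x) (at x)"
    and u'': "(u' has_real_derivative c) (at a)"
    and min: "\<And>x. u a \<le> u x"
  shows "u' a = 0" and "0 \<le> c"
proof -
  show stationary: "u' a = 0"
    using DERIV_local_min[OF u', of 1 a] min by simp
  show "0 \<le> c"
  proof (rule ccontr)
    assume "\<not> 0 \<le> c"
    then obtain d where "d > 0" and d: "\<And>h. 0 < h \<Longrightarrow> h < d \<Longrightarrow> u' (a + h) < 0"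
      using DERIV_neg_dec_right[OF u''] stationary by auto
    have "u (a + d/2) < u a"
    proof (rule DERIV_neg_imp_decreasing_open[of a "a + d/2" u])
      fix x assume "a < x" "x < a + d/2"
      then show "\<exists>y. (u has_real_derivative y) (at x) \<and> y < 0"
        using u' d[of "x - a"] \<open>d > 0\<close> by auto
    next
      show "continuous_on {a..a + d/2} u"
        by (meson DERIV_continuous_on u' has_field_derivative_at_within)
    qed (use \<open>d > 0\<close> in auto)
    with min[of "a + d/2"] show False by simp
  qed
qed

text \<open>Rotation by \<open>t\<close> turns \<open>d/dt\<close> into \<open>\<i> euler\<close>. The factor \<open>c\<close> lets the rule be iterated: the
  derivative of the case \<open>c = 1\<close> is the case \<open>c = \<i>\<close> for the function \<open>euler g\<close>.\<close>

lemma has_real_derivative_Re_circle: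
  assumes "g holomorphic_on S" "open S" "z * exp (\<i> * of_real t) \<in> S"
  shows "((\<lambda>s. Re (c * g (z * exp (\<i> * of_real s)))) has_real_derivative
           Re (\<i> * c * euler g (z * exp (\<i> * of_real t)))) (at t)"
proof -
  let ?e = "\<lambda>s::complex. z * exp (\<i> * s)"
  have "(g has_field_derivative deriv g (?e (of_real t))) (at (?e (of_real t)))"
    using assms holomorphic_derivI by blast
  then have "((\<lambda>s. c * g (?e s)) has_field_derivative \<i> * c * euler g (?e (of_real t)))
          (at (of_real t))"
    by (auto intro!: derivative_eq_intros DERIV_chain2[where f = g] simp: euler_def)
  from has_vector_derivative_real_field[OF this]
  show ?thesis
    unfolding has_real_derivative_iff_has_vector_derivative
    by (rule bounded_linear.has_vector_derivative[OF bounded_linear_Re])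
qed

text \<open>The set of points of the closed disc of radius \<open>norm w\<close> at which \<open>Re p \<le> 0\<close> is compact, and a
  point of least modulus in it has the required properties: \<open>Re p\<close> is positive at all points of
  smaller modulus, hence nonnegative on the closed disc by continuity.\<close>

lemma first_imaginary_value:
  assumes holo: "p holomorphic_on ball 0 R" and pos: "Re (p 0) > 0"
    and w: "w \<in> ball 0 R" "Re (p w) \<le> 0"
  obtains z where "z \<in> ball 0 R" "z \<noteq> 0" "Re (p z) = 0"
    "\<And>y. norm y \<le> norm z \<Longrightarrow> Re (p y) \<ge> 0"
proof -
  define K where "K = {y \<in> cball 0 (norm w). Re (p y) \<in> {..0}}"
  have cball_subset: "cball 0 (norm w) \<subseteq> ball 0 R" using w by auto
  then have cont: "continuous_on (cball 0 (norm w)) (\<lambda>y. Re (p y))"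
    by (intro continuous_intros holomorphic_on_imp_continuous_on holomorphic_on_subset[OF holo])
  have "compact K"
  proof -
    have "K = cball 0 (norm w) \<inter> (\<lambda>y. Re (p y)) -` {..0}" by (auto simp: K_def)
    then have "closed K" using continuous_closed_preimage[OF cont] by simp
    moreover have "bounded K" by (rule bounded_subset[OF bounded_cball[of 0 "norm w"]]) (auto simp: K_def)
    ultimately show ?thesis by (simp add: compact_eq_bounded_closed)
  qed
  moreover have "w \<in> K" using w by (simp add: K_def)
  ultimately obtain z where "z \<in> K" and least: "\<And>y. y \<in> K \<Longrightarrow> norm z \<le> norm y"
    using continuous_attains_inf[of K norm] by (metis continuous_on_norm_id empty_iff)
  have "z \<noteq> 0" using pos \<open>z \<in> K\<close> by (auto simp: K_def)
  have inside: "Re (p y) \<ge> 0" if "y \<in> ball 0 (norm z)" for y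
    using least[of y] that \<open>z \<in> K\<close> by (force simp: K_def)
  have "Re (p y) \<ge> 0" if "norm y \<le> norm z" for y
  proof (rule continuous_ge_on_closure[of "ball 0 (norm z)" "\<lambda>y. Re (p y)"])
    show "continuous_on (closure (ball 0 (norm z))) (\<lambda>y. Re (p y))"
      using \<open>z \<noteq> 0\<close> \<open>z \<in> K\<close> by (auto intro: continuous_on_subset[OF cont] simp: K_def)
  qed (use that \<open>z \<noteq> 0\<close> inside in auto)
  moreover from this[of z] \<open>z \<in> K\<close> have "Re (p z) = 0" by (auto simp: K_def)
  ultimately show ?thesis
    using that[of z] \<open>z \<noteq> 0\<close> \<open>z \<in> K\<close> cball_subset unfolding K_def by blast
qed

text \<open>A second-order version of the boundary lemma of Jack, Miller and Mocanu. The three conclusions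
  on \<open>euler p\<close> come from the first and second angular derivatives and from the radial
  derivative of \<open>Re p\<close>.\<close>

lemma euler_at_first_imaginary_value:
  assumes holo: "p holomorphic_on ball 0 R" and pos: "Re (p 0) > 0"
    and w: "w \<in> ball 0 R" "Re (p w) \<le> 0"
  obtains z where "z \<in> ball 0 R" "z \<noteq> 0" "Re (p z) = 0"
    "Im (euler p z) = 0" "Re (euler p z) \<le> 0" "Re (euler (euler p) z) \<le> 0"
proof -
  obtain z where z: "z \<in> ball 0 R" "z \<noteq> 0" "Re (p z) = 0"
    and disc: "\<And>y. norm y \<le> norm z \<Longrightarrow> Re (p y) \<ge> 0"
    using first_imaginary_value[OF assms] by blast
  define e where "e = (\<lambda>t::real. z * exp (\<i> * of_real t))"
  have e_in: "e t \<in> ball 0 R" and e_norm: "norm (e t) = norm z" for t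
    using z by (auto simp: e_def norm_mult)
  have e0: "e 0 = z" by (simp add: e_def)
  have u': "((\<lambda>t. Re (p (e t))) has_real_derivative Re (\<i> * euler p (e t))) (at t)" for t
    using has_real_derivative_Re_circle[OF holo open_ball, of z t 1] e_in by (simp add: e_def)
  have u'': "((\<lambda>t. Re (\<i> * euler p (e t))) has_real_derivative - Re (euler (euler p) z)) (at 0)"
    using has_real_derivative_Re_circle[OF holomorphic_on_euler[OF holo open_ball] open_ball,
        of z 0 \<i>] z(1) by (simp add: e_def)
  have min: "Re (p (e 0)) \<le> Re (p (e t))" for t
    using disc[of "e t"] z by (simp add: e0 e_norm)
  note test = second_deriv_nonneg_at_min[OF u' u'' min]
  have radial: "((\<lambda>s. Re (p (of_real s * z))) has_real_derivative Re (euler p z)) (at 1)"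
  proof -
    have "(p has_field_derivative deriv p z) (at (1 * z))"
      using holo z(1) holomorphic_derivI by fastforce
    then have "((\<lambda>s. p (s * z)) has_field_derivative deriv p z * z) (at 1)"
      by (rule DERIV_chain2[where f = p and g = "\<lambda>s. s * z"]) (auto intro!: derivative_eq_intros)
    then have "((\<lambda>s. p (s * z)) has_field_derivative euler p z) (at (of_real 1))"
      by (simp add: euler_def mult.commute)
    from has_vector_derivative_real_field[OF this]
    show ?thesis
      unfolding has_real_derivative_iff_has_vector_derivative
      by (rule bounded_linear.has_vector_derivative[OF bounded_linear_Re])
  qed
  have "Re (euler p z) \<le> 0"
  proof (rule ccontr)
    assume "\<not> ?thesis"
    then obtain d where "d > 0"
      and d: "\<And>h. 0 < h \<Longrightarrow> h < d \<Longrightarrow> Re (p (of_real (1 - h) * z)) < Re (p z)"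
      using DERIV_pos_inc_left[OF radial] by auto
    \<comment> \<open>The bound \<open>h \<le> 1\<close> keeps \<open>(1 - h) z\<close> from passing through the centre and out of the disc.\<close>
    define h where "h = min 1 (d/2)"
    have h: "0 < h" "h < d" "h \<le> 1" using \<open>d > 0\<close> by (auto simp: h_def)
    then have "norm (of_real (1 - h) * z) \<le> norm z"
      by (simp only: norm_mult norm_of_real) (simp add: mult_left_le_one_le)
    with d[OF h(1,2)] disc z(3) show False by fastforce
  qed
  with z test that show ?thesis by (simp add: e0)
qed

section \<open>The three quantities in terms of \<open>Q_ST f\<close>\<close>

locale nonvanishing_class_A =
  fixes f :: "complex \<Rightarrow> complex"
  assumes in_class_A: "f \<in> class_A"
    and nonvanishing: "\<forall>z\<in>unit_disc. ff'_over_z f z \<noteq> 0"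
begin

lemma holo: "f holomorphic_on unit_disc" and f_0: "f 0 = 0" and deriv_0: "deriv f 0 = 1"
  using in_class_A by (auto simp: class_A_def)

lemma holo_deriv: "deriv f holomorphic_on unit_disc"
  by (intro holomorphic_intros holo open_ball)

lemma holo_deriv2: "deriv (deriv f) holomorphic_on unit_disc"
  by (intro holomorphic_intros holo_deriv open_ball)

lemma deriv_nz: "z \<in> unit_disc \<Longrightarrow> deriv f z \<noteq> 0"
  using nonvanishing deriv_0 by (cases "z = 0") (force simp: ff'_over_z_def)+

lemma f_nz: "z \<in> unit_disc \<Longrightarrow> z \<noteq> 0 \<Longrightarrow> f z \<noteq> 0"
  using nonvanishing by (force simp: ff'_over_z_def)

lemma Q_ST_nz: "z \<in> unit_disc \<Longrightarrow> Q_ST f z \<noteq> 0"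
  using deriv_nz f_nz by (auto simp: Q_ST_def)

text \<open>Holomorphy away from the origin is clear from the quotient, and at the origin continuity
  suffices by Riemann's theorem on removable singularities: \<open>z / f z\<close> and \<open>deriv f z\<close> both tend
  to \<open>1\<close>.\<close>

lemma holo_Q_ST: "Q_ST f holomorphic_on unit_disc"
proof (rule no_isolated_singularity)
  have "(\<lambda>z. z * deriv f z / f z) holomorphic_on unit_disc - {0}"
    using f_nz by (intro holomorphic_intros holomorphic_on_subset[OF holo]
        holomorphic_on_subset[OF holo_deriv]) auto
  then show punctured: "Q_ST f holomorphic_on unit_disc - {0}"
    by (rule holomorphic_transform) (auto simp: Q_ST_def)
  have "isCont (Q_ST f) 0"
  proof -
    have "(f has_field_derivative 1) (at 0)"
      using holomorphic_derivI[OF holo, of 0] deriv_0 by simp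
    then have "(\<lambda>z. f z / z) \<midarrow>0\<rightarrow> 1"
      using f_0 by (simp add: has_field_derivative_iff)
    moreover have "deriv f \<midarrow>0\<rightarrow> 1"
      using holomorphic_on_imp_continuous_on[OF holo_deriv] deriv_0
      by (metis centre_in_ball continuous_on_eq_continuous_at isCont_def open_ball zero_less_one)
    ultimately have "(\<lambda>z. deriv f z / (f z / z)) \<midarrow>0\<rightarrow> 1 / 1"
      by (intro tendsto_intros) auto
    then have "Q_ST f \<midarrow>0\<rightarrow> 1"
      by (rule Lim_transform_eventually[OF tendsto_eq_rhs])
         (auto simp: Q_ST_def eventually_at_filter mult.commute)
    then show ?thesis by (simp add: isCont_def Q_ST_def)
  qed
  moreover have "isCont (Q_ST f) z" if "z \<in> unit_disc - {0}" for z
    using holomorphic_on_imp_continuous_on[OF punctured] that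
    by (simp add: continuous_on_eq_continuous_at open_Diff)
  ultimately show "continuous_on unit_disc (Q_ST f)"
    by (metis Diff_iff continuous_at_imp_continuous_on singletonD)
qed auto

lemma holo_euler_Q_ST: "euler (Q_ST f) holomorphic_on unit_disc"
  by (intro holomorphic_on_euler holo_Q_ST open_ball)

text \<open>Away from the origin this comes from the logarithmic derivative of \<open>z f'(z) / f(z)\<close>. At the
  origin both sides equal \<open>1\<close>.\<close>

lemma Q_CV_eq:
  assumes z: "z \<in> unit_disc"
  shows "Q_CV f z = Q_ST f z + euler (Q_ST f) z / Q_ST f z"
proof (cases "z = 0")
  case True
  then show ?thesis by (simp add: Q_CV_def Q_ST_def euler_def)
next
  case False
  have d: "(f has_field_derivative deriv f z) (at z)"
    "(deriv f has_field_derivative deriv (deriv f) z) (at z)"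
    using holomorphic_derivI[OF holo open_ball z] holomorphic_derivI[OF holo_deriv open_ball z]
    by auto
  have "\<forall>\<^sub>F w in nhds z. w \<noteq> 0"
    using False by (simp add: t1_space_nhds)
  then have "deriv (Q_ST f) z = deriv (\<lambda>w. w * deriv f w / f w) z"
    by (intro deriv_cong_ev) (auto simp: Q_ST_def elim: eventually_mono)
  also have "\<dots> = ((deriv f z + z * deriv (deriv f) z) * f z - z * deriv f z * deriv f z)
                     / (f z * f z)"
    using d f_nz[OF z False]
    by (intro DERIV_imp_deriv) (auto intro!: derivative_eq_intros simp: algebra_simps)
  finally show ?thesis
    using False f_nz[OF z False] deriv_nz[OF z]
    by (simp add: Q_CV_def Q_ST_def euler_def field_simps)
qed

text \<open>With \<open>P = f'' / f'\<close> the Schwarzian is \<open>P' - P\<^sup>2 / 2\<close>, and \<open>Q_CV f z = 1 + z P\<close>. Eliminating \<open>P\<close>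
  expresses it through \<open>Q_CV f\<close> alone.\<close>

lemma Q_SD_eq_Q_CV:
  assumes z: "z \<in> unit_disc"
  shows "Q_SD f z = euler (Q_CV f) z + (1 - (Q_CV f z)\<^sup>2) / 2"
proof -
  let ?P = "\<lambda>w. deriv (deriv f) w / deriv f w"
  have "?P holomorphic_on unit_disc"
    by (intro holomorphic_intros holo_deriv holo_deriv2 deriv_nz)
  then have "(?P has_field_derivative deriv ?P z) (at z)"
    using z holomorphic_derivI open_ball by blast
  from DERIV_mult[OF DERIV_ident this]
  have "deriv (\<lambda>w. 1 + w * ?P w) z = ?P z + z * deriv ?P z"
    by (intro DERIV_imp_deriv DERIV_cong[OF DERIV_add[OF DERIV_const]]) (assumption, simp)
  then have "euler (Q_CV f) z = z * (?P z + z * deriv ?P z)"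
    by (simp add: euler_def Q_CV_def[abs_def])
  moreover have "Q_CV f z = 1 + z * ?P z" by (simp add: Q_CV_def)
  ultimately show ?thesis
    unfolding Q_SD_def schwarzian_def by algebra
qed

lemma Q_SD_eq:
  assumes z: "z \<in> unit_disc"
  defines "p \<equiv> Q_ST f"
  shows "Q_SD f z = euler (euler p) z / p z - 3/2 * (euler p z / p z)\<^sup>2 + (1 - (p z)\<^sup>2) / 2"
proof -
  have diff: "p field_differentiable at z" "euler p field_differentiable at z"
    using holo_Q_ST holo_euler_Q_ST z
    by (auto simp: p_def intro: holomorphic_on_imp_differentiable_at)
  have nz: "p z \<noteq> 0" using Q_ST_nz[OF z] by (simp add: p_def)
  have "\<forall>\<^sub>F w in nhds z. w \<in> unit_disc"
    using z by (intro eventually_nhds_in_open) auto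
  then have "euler (Q_CV f) z = z * deriv (\<lambda>w. p w + euler p w / p w) z"
    unfolding euler_def[of "Q_CV f"]
    by (intro arg_cong[of _ _ "(*) z"] deriv_cong_ev) (auto simp: Q_CV_eq p_def elim: eventually_mono)
  also have "\<dots> = euler p z + euler (\<lambda>w. euler p w / p w) z"
    using diff nz
    by (simp add: euler_def[of "\<lambda>w. euler p w / p w"] euler_def[of p z] field_differentiable_divide
        distrib_left)
  also have "\<dots> = euler p z + (euler (euler p) z * p z - euler p z * euler p z) / (p z)\<^sup>2"
    by (simp add: euler_quotient diff nz)
  finally have euler_CV:
    "euler (Q_CV f) z = euler p z + euler (euler p) z / p z - (euler p z / p z)\<^sup>2"
    using nz by (simp add: diff_divide_distrib power_divide power2_eq_square)
  moreover have "(p z + euler p z / p z)\<^sup>2 = (p z)\<^sup>2 + 2 * euler p z + (euler p z / p z)\<^sup>2"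
    using nz by (simp add: power2_sum)
  ultimately show ?thesis
    unfolding Q_SD_eq_Q_CV[OF z] Q_CV_eq[OF z] p_def[symmetric]
    by (simp add: diff_divide_distrib add_divide_distrib)
qed

section \<open>The point that violates the inequalities\<close>

text \<open>At the first imaginary value of \<open>Q_ST f\<close>, the numbers \<open>Q_ST f z\<close> and \<open>Q_CV f z\<close> are both
  imaginary and differ by a nonnegative real factor \<open>k\<close>. This factor carries the sign of
  \<open>Re (Q_SD f z * Q_ST f z)\<close> over to \<open>Re (Q_SD f z * Q_CV f z)\<close>.\<close>

lemma obstruction:
  assumes "\<not> starlike_function f"
  obtains z \<rho> \<tau> where "z \<in> unit_disc" "Q_ST f z = \<i> * of_real \<rho>" "Q_CV f z = \<i> * of_real \<tau>"
    "Re (Q_SD f z * Q_ST f z) \<le> 0" "Re (Q_SD f z * Q_CV f z) \<le> 0"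
proof -
  obtain w where w: "w \<in> unit_disc" "Re (Q_ST f w) \<le> 0"
    using assms in_class_A by (auto simp: starlike_function_def not_less)
  have "Re (Q_ST f 0) > 0" by (simp add: Q_ST_def)
  from euler_at_first_imaginary_value[OF holo_Q_ST this w]
  obtain z where z: "z \<in> unit_disc" "Re (Q_ST f z) = 0"
    and first: "Im (euler (Q_ST f) z) = 0" "Re (euler (Q_ST f) z) \<le> 0"
    and second: "Re (euler (euler (Q_ST f)) z) \<le> 0"
    by blast
  define \<rho> where "\<rho> = Im (Q_ST f z)"
  define \<sigma> where "\<sigma> = Re (euler (Q_ST f) z)"
  define k where "k = 1 - \<sigma> / \<rho>\<^sup>2"
  have ST: "Q_ST f z = \<i> * of_real \<rho>" using z by (simp add: \<rho>_def complex_eq_iff)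
  have E: "euler (Q_ST f) z = of_real \<sigma>" using first by (simp add: \<sigma>_def complex_eq_iff)
  have "\<rho> \<noteq> 0" using Q_ST_nz[OF z(1)] ST by auto
  have "k \<ge> 0" using first \<open>\<rho> \<noteq> 0\<close> by (simp add: k_def \<sigma>_def divide_nonpos_nonneg order_trans[of _ 0])
  have CV: "Q_CV f z = of_real k * Q_ST f z"
    unfolding Q_CV_eq[OF z(1)] ST E using \<open>\<rho> \<noteq> 0\<close>
    by (simp add: k_def field_simps power2_eq_square)
  have "Q_SD f z * Q_ST f z = euler (euler (Q_ST f)) z
      + \<i> * of_real (3/2 * \<sigma>\<^sup>2 / \<rho> + \<rho> * (1 + \<rho>\<^sup>2) / 2)"
    unfolding Q_SD_eq[OF z(1)] ST E using \<open>\<rho> \<noteq> 0\<close>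
    by (simp add: field_simps power2_eq_square)
  then have SDST: "Re (Q_SD f z * Q_ST f z) \<le> 0" using second by simp
  have "Re (Q_SD f z * Q_CV f z) = k * Re (Q_SD f z * Q_ST f z)"
    unfolding CV by (simp add: algebra_simps)
  also have "\<dots> \<le> 0" using SDST \<open>k \<ge> 0\<close> by (simp add: mult_nonneg_nonpos)
  finally show ?thesis
    using that[of z \<rho> "k * \<rho>"] z(1) ST CV SDST by simp
qed

end

theorem theorem2p6:
  fixes \<alpha> \<beta> :: real and f :: "complex \<Rightarrow> complex"
  assumes "\<alpha> > 0" and "\<beta> \<ge> 0"
    and "f \<in> class_A"
    and "\<forall>z\<in>unit_disc. ff'_over_z f z \<noteq> 0"
    and "(\<forall>z\<in>unit_disc.
            Re (of_real \<beta> * Q_SD f z * Q_ST f z + of_real \<alpha> * (1 + Q_CV f z)\<^sup>2) > \<alpha>)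
       \<or> (\<forall>z\<in>unit_disc.
            Re (of_real \<beta> * Q_SD f z * Q_ST f z + of_real \<alpha> * (1 + Q_ST f z)\<^sup>2) > \<alpha>)
       \<or> (\<forall>z\<in>unit_disc.
            Re (of_real \<beta> * Q_SD f z * Q_CV f z + of_real \<alpha> * (1 + Q_CV f z)\<^sup>2) > \<alpha>)
       \<or> (\<forall>z\<in>unit_disc.
            Re (of_real \<beta> * Q_SD f z * Q_CV f z + of_real \<alpha> * (1 + Q_ST f z)\<^sup>2) > \<alpha>)"
  shows "starlike_function f"
proof (rule ccontr)
  interpret nonvanishing_class_A f using assms(3,4) by unfold_locales
  assume "\<not> starlike_function f"
  then obtain z \<rho> \<tau> where z: "z \<in> unit_disc"
    and vals: "Q_ST f z = \<i> * of_real \<rho>" "Q_CV f z = \<i> * of_real \<tau>"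
    and SD: "Re (Q_SD f z * Q_ST f z) \<le> 0" "Re (Q_SD f z * Q_CV f z) \<le> 0"
    by (rule obstruction)
  \<comment> \<open>One bound covers the four cases: \<open>A\<close> and \<open>B\<close> each stand for \<open>Q_ST f z\<close> or \<open>Q_CV f z\<close>.\<close>
  have le: "Re (of_real \<beta> * Q_SD f z * A + of_real \<alpha> * (1 + B)\<^sup>2) \<le> \<alpha>"
    if "Re (Q_SD f z * A) \<le> 0" "B = \<i> * of_real b" for A B b
  proof -
    have "Re (of_real \<beta> * Q_SD f z * A + of_real \<alpha> * (1 + B)\<^sup>2)
        = \<beta> * Re (Q_SD f z * A) + \<alpha> * (1 - b\<^sup>2)"
      using that(2) by (simp add: power2_eq_square algebra_simps)
    also have "\<dots> \<le> 0 + \<alpha> * 1"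
      using that(1) assms(1,2) by (intro add_mono mult_left_mono mult_nonneg_nonpos) auto
    finally show ?thesis by simp
  qed
  note bounds = le[OF SD(1) vals(2)] le[OF SD(1) vals(1)]
    le[OF SD(2) vals(2)] le[OF SD(2) vals(1)]
  from assms(5) show False
    using bounds z by (meson not_less)
qed

end
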